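(* Let $k\ge1$, $a_0,\dots,a_k\in\mathbb{Z}$, and let $P=\min_{0\le i\le k}\{a_i+u^{(i)}\}$ be a tropical linear differential equation in one unknown. The following are equivalent: (i) $P$ is non-holonomic; (ii) $\{s\}$ is a solution of $P$ for some $s\ge k$. In this case $\{q\}$ is a solution of $P$ for every $q\ge k$.
   Context: For $S\subseteq\mathbb{Z}_{\ge0}$, $\mathrm{val}_S(i)=\min\{s-i:s\in S,\ s\ge i\}$ ($\infty$ if no such $s$). A nonempty $S\subseteq\mathbb{Z}_{\ge0}$ is a solution of $P$ if $\min_{0\le i\le k}\{a_i+\mathrm{val}_S(i)\}$ is attained for at least two values of $i$. A minimal solution is a nonempty solution minimal with respect to inclusion among nonempty solutions. $P$ is holonomic if it has finitely many minimal solutions, and non-holonomic otherwise. *)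

theory Defs
  imports "HOL-Library.Extended_Real"
begin

(* The equation P = min {a i + u^(i) | 0 <= i <= k} is represented by its order k and its
   coefficient sequence a; the values a i with i > k are never used. *)

(* The infimum in enat is the minimum of a nonempty set and is infinity for the empty set. *)
definition val :: "nat set \<Rightarrow> nat \<Rightarrow> enat" where
  "val S i = Inf {enat (s - i) |s. s \<in> S \<and> s \<ge> i}"

definition trop_term :: "(nat \<Rightarrow> int) \<Rightarrow> nat set \<Rightarrow> nat \<Rightarrow> ereal" where
  "trop_term a S i = ereal (real_of_int (a i)) + ereal_of_enat (val S i)"

definition solution :: "nat \<Rightarrow> (nat \<Rightarrow> int) \<Rightarrow> nat set \<Rightarrow> bool" where
  "solution k a S \<longleftrightarrow> S \<noteq> {} \<and>
     card {i \<in> {0..k}. trop_term a S i = Min (trop_term a S ` {0..k})} \<ge> 2"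

definition minimal_solution :: "nat \<Rightarrow> (nat \<Rightarrow> int) \<Rightarrow> nat set \<Rightarrow> bool" where
  "minimal_solution k a S \<longleftrightarrow>
     solution k a S \<and> (\<forall>T. solution k a T \<and> T \<subseteq> S \<longrightarrow> T = S)"

definition holonomic :: "nat \<Rightarrow> (nat \<Rightarrow> int) \<Rightarrow> bool" where
  "holonomic k a \<longleftrightarrow> finite {S. minimal_solution k a S}"

end

theory Submission
  imports Defs
begin

text \<open>
  Let \<open>S\<close> be a solution whose minimum is attained at \<open>i < j\<close>, and let \<open>s\<close> and \<open>t\<close> be the least
  elements of \<open>S\<close> that are at least \<open>i\<close> and \<open>j\<close>, respectively. Passing to a subset can only
  increase \<open>val\<close>, and \<open>{s, t}\<close> keeps the values at \<open>i\<close> and \<open>j\<close>, so \<open>{s, t}\<close> is already a solution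
  (lemma \<open>solution_contains_pair\<close>). Hence a minimal solution is such a set
  \<open>{s, t}\<close>, where \<open>s \<le> t\<close>, and \<open>s < t\<close> forces \<open>s < j \<le> k\<close>, while \<open>t\<close> is determined by
  \<open>i\<close>, \<open>j\<close> and \<open>s\<close> through \<open>a i + (s - i) = a j + (t - j)\<close>. So only
  finitely many minimal solutions have two elements, and if no \<open>{s}\<close> with \<open>s \<ge> k\<close> is a solution, then \<open>P\<close> is holonomic.

  Conversely, for \<open>s \<ge> k\<close> the terms of \<open>P\<close> at \<open>{s}\<close> are \<open>(a i - i) + s\<close>. Whether their minimum is
  attained twice does not depend on \<open>s\<close>, so one solution \<open>{s}\<close> with \<open>s \<ge> k\<close> yields all of them
  (lemma \<open>solution_singleton_iff\<close>). These are infinitely many minimal solutions, as a singleton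
  has no proper nonempty subset.
\<close>

lemma val_antimono: "T \<subseteq> S \<Longrightarrow> val S i \<le> val T i"
  unfolding val_def by (rule Inf_superset_mono) auto

lemma val_eq_least:
  assumes "s \<in> S" "i \<le> s" "\<And>t. t \<in> S \<Longrightarrow> i \<le> t \<Longrightarrow> s \<le> t"
  shows "val S i = enat (s - i)"
  unfolding val_def
proof (rule antisym)
  show "Inf {enat (s - i) |s. s \<in> S \<and> i \<le> s} \<le> enat (s - i)"
    using assms(1,2) by (intro Inf_lower) auto
  show "enat (s - i) \<le> Inf {enat (s - i) |s. s \<in> S \<and> i \<le> s}"
    using assms(3) by (intro Inf_greatest) (auto intro!: diff_le_mono)
qed

lemma val_finiteE:
  assumes "val S i \<noteq> \<infinity>"
  obtains s where "s \<in> S" "i \<le> s" "\<And>t. t \<in> S \<Longrightarrow> i \<le> t \<Longrightarrow> s \<le> t" "val S i = enat (s - i)"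
proof -
  have "\<exists>s. s \<in> S \<and> i \<le> s"
  proof (rule ccontr)
    assume "\<nexists>s. s \<in> S \<and> i \<le> s"
    then have "val S i = Inf {}"
      unfolding val_def by (intro arg_cong[where f = Inf]) auto
    with assms show False by (simp add: top_enat_def)
  qed
  then obtain s where "s \<in> S" "i \<le> s" "\<And>t. t \<in> S \<Longrightarrow> i \<le> t \<Longrightarrow> s \<le> t"
    using exists_least_iff[of "\<lambda>s. s \<in> S \<and> i \<le> s"] by (meson not_le_imp_less)
  then show thesis using that val_eq_least by blast
qed

lemma trop_term_antimono: "T \<subseteq> S \<Longrightarrow> trop_term a S i \<le> trop_term a T i"
  unfolding trop_term_def using val_antimono by (intro add_left_mono) simp

lemma trop_term_eq:
  assumes "val S i = enat (s - i)" "i \<le> s"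
  shows "trop_term a S i = ereal (real_of_int (a i + int s - int i))"
  using assms by (simp add: trop_term_def)

lemma solution_iff:
  "solution k a S \<longleftrightarrow> S \<noteq> {} \<and>
    (\<exists>i j. i < j \<and> j \<le> k \<and> trop_term a S i = trop_term a S j \<and>
      (\<forall>l\<le>k. trop_term a S i \<le> trop_term a S l))"
proof -
  let ?t = "trop_term a S"
  let ?A = "{i \<in> {0..k}. ?t i = Min (?t ` {0..k})}"
  define A where "A = ?A"
  have min: "i \<in> A \<longleftrightarrow> i \<le> k \<and> (\<forall>l\<le>k. ?t i \<le> ?t l)" for i
    unfolding A_def by (auto simp: eq_Min_iff)
  have "finite A" by (simp add: A_def)
  have "card A \<ge> 2 \<longleftrightarrow> \<not> card A \<le> Suc 0" by linarith
  also have "\<dots> \<longleftrightarrow> (\<exists>i\<in>A. \<exists>j\<in>A. i \<noteq> j)"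
    unfolding card_le_Suc0_iff_eq[OF \<open>finite A\<close>] by blast
  also have "\<dots> \<longleftrightarrow> (\<exists>i\<in>A. \<exists>j\<in>A. i < j)"
    by (auto simp: nat_neq_iff)
  also have "\<dots> \<longleftrightarrow> (\<exists>i j. i < j \<and> j \<le> k \<and> ?t i = ?t j \<and> (\<forall>l\<le>k. ?t i \<le> ?t l))"
  proof (intro iffI; elim bexE exE conjE)
    fix i j assume "i \<in> A" "j \<in> A" "i < j"
    moreover from this have "?t i = ?t j" unfolding min by (intro antisym) auto
    ultimately show "\<exists>i j. i < j \<and> j \<le> k \<and> ?t i = ?t j \<and> (\<forall>l\<le>k. ?t i \<le> ?t l)"
      unfolding min by blast
  next
    fix i j assume "i < j" "j \<le> k" "?t i = ?t j" "\<forall>l\<le>k. ?t i \<le> ?t l"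
    then show "\<exists>i\<in>A. \<exists>j\<in>A. i < j"
      by (intro bexI[of _ i] bexI[of _ j]) (simp_all add: min)
  qed
  finally show ?thesis unfolding solution_def A_def by simp
qed

lemma trop_term_singleton:
  "i \<le> s \<Longrightarrow> trop_term a {s} i = ereal (real_of_int (a i + int s - int i))"
  by (intro trop_term_eq val_eq_least) auto

lemma solution_singleton_iff:
  assumes "k \<le> s"
  shows "solution k a {s} \<longleftrightarrow>
    (\<exists>i j. i < j \<and> j \<le> k \<and> a i - int i = a j - int j \<and> (\<forall>l\<le>k. a i - int i \<le> a l - int l))"
proof -
  let ?t = "trop_term a {s}"
  have le: "?t i \<le> ?t j \<longleftrightarrow> a i - int i \<le> a j - int j" if "i \<le> k" "j \<le> k" for i j
  proof -
    have "?t i \<le> ?t j \<longleftrightarrow> a i + int s - int i \<le> a j + int s - int j"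
      using that assms by (simp add: trop_term_singleton del: of_int_add of_int_diff)
    then show ?thesis by linarith
  qed
  have eq: "?t i = ?t j \<longleftrightarrow> a i - int i = a j - int j" if "i \<le> k" "j \<le> k" for i j
    using le[OF that] le[OF that(2,1)] by (auto simp: order_eq_iff)
  have "(i < j \<and> j \<le> k \<and> ?t i = ?t j \<and> (\<forall>l\<le>k. ?t i \<le> ?t l)) \<longleftrightarrow>
    (i < j \<and> j \<le> k \<and> a i - int i = a j - int j \<and> (\<forall>l\<le>k. a i - int i \<le> a l - int l))" for i j
    using le[of i] eq[of i j] by (cases "i < j \<and> j \<le> k") auto
  then show ?thesis unfolding solution_iff by simp
qed

text \<open>
  The alternative \<open>s = t \<or> s < j\<close> bounds \<open>s\<close>: an element of \<open>S\<close> that is at least \<open>j\<close> and is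
  the least one in \<open>{i..}\<close> is also the least one in \<open>{j..}\<close>.
\<close>

lemma solution_contains_pair:
  assumes "solution k a S"
  obtains i j s t where "i < j" "j \<le> k" "s \<in> S" "t \<in> S" "solution k a {s, t}"
    "s = t \<or> s < j" "a i + int s - int i = a j + int t - int j"
proof -
  let ?t = "trop_term a S"
  from assms obtain i j where "S \<noteq> {}" and ij: "i < j" "j \<le> k" and eq: "?t i = ?t j"
    and min: "\<And>l. l \<le> k \<Longrightarrow> ?t i \<le> ?t l"
    unfolding solution_iff by blast
  from \<open>S \<noteq> {}\<close> obtain r where "r \<in> S" by blast
  \<comment> \<open>The minimum is finite, because the term at index \<open>0\<close> is.\<close>
  have "?t 0 \<le> trop_term a {r} 0" using \<open>r \<in> S\<close> by (intro trop_term_antimono) simp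
  then have "?t i < \<infinity>" using min[of 0] by (auto simp: trop_term_singleton)
  then have "?t i \<noteq> \<infinity>" "?t j \<noteq> \<infinity>" using eq by simp_all
  moreover have "?t l = \<infinity>" if "val S l = \<infinity>" for l
    using that by (simp add: trop_term_def)
  ultimately have "val S i \<noteq> \<infinity>" "val S j \<noteq> \<infinity>" by blast+
  from val_finiteE[OF this(1)] obtain s
    where s: "s \<in> S" "i \<le> s" "\<And>r. r \<in> S \<Longrightarrow> i \<le> r \<Longrightarrow> s \<le> r" "val S i = enat (s - i)"
    by blast
  from val_finiteE[OF \<open>val S j \<noteq> \<infinity>\<close>] obtain t
    where t: "t \<in> S" "j \<le> t" "\<And>r. r \<in> S \<Longrightarrow> j \<le> r \<Longrightarrow> t \<le> r" "val S j = enat (t - j)"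
    by blast
  let ?T = "{s, t}"
  have sub: "?T \<subseteq> S" using s t by simp
  have "val ?T i = enat (s - i)" "val ?T j = enat (t - j)"
    using s t sub by (auto intro!: val_eq_least)
  then have T: "trop_term a ?T i = ?t i" "trop_term a ?T j = ?t j"
    using s(4) t(4) by (simp_all add: trop_term_def)
  have "?t i \<le> trop_term a ?T l" if "l \<le> k" for l
    using min[OF that] trop_term_antimono[OF sub] by (rule order_trans)
  then have "solution k a ?T"
    unfolding solution_iff using ij eq
    by (intro conjI exI[of _ i] exI[of _ j]) (simp_all only: T, simp_all)
  moreover have "s = t \<or> s < j"
  proof (rule disjCI)
    assume "\<not> s < j"
    then show "s = t"
      using s(3)[OF t(1)] t(3)[OF s(1)] ij t(2) by simp
  qed
  moreover have "a i + int s - int i = a j + int t - int j"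
    using eq trop_term_eq[OF s(4,2), of a] trop_term_eq[OF t(4,2), of a]
    by (simp del: of_int_add of_int_diff)
  ultimately show thesis using that ij s t by blast
qed

lemma holonomic_if_no_large_singleton:
  assumes "\<And>s. k \<le> s \<Longrightarrow> \<not> solution k a {s}"
  shows "holonomic k a"
proof -
  \<comment> \<open>Contains the larger element of every minimal solution that has two elements.\<close>
  let ?E = "(\<lambda>(i, j, s). nat (a i + int s - int i - a j + int j)) ` ({..k} \<times> {..k} \<times> {..<k})"
  have "S \<subseteq> {..<k} \<union> ?E" if S: "minimal_solution k a S" for S
  proof -
    from S have "solution k a S" by (simp add: minimal_solution_def)
    then obtain i j s t where *: "i < j" "j \<le> k" "s \<in> S" "t \<in> S" "solution k a {s, t}"
      "s = t \<or> s < j" "a i + int s - int i = a j + int t - int j"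
      by (rule solution_contains_pair)
    then have S_eq: "S = {s, t}" using S by (auto simp: minimal_solution_def)
    show ?thesis
    proof (cases "s = t")
      case True
      with * assms[of s] show ?thesis by (auto simp: S_eq)
    next
      case False
      with * have "s < k" "i \<le> k" by auto
      moreover have "t = nat (a i + int s - int i - a j + int j)" using * by simp
      ultimately have "t \<in> ?E" using * by (intro image_eqI[of _ _ "(i, j, s)"]) auto
      with \<open>s < k\<close> show ?thesis by (simp add: S_eq)
    qed
  qed
  then have "{S. minimal_solution k a S} \<subseteq> Pow ({..<k} \<union> ?E)" by blast
  then show ?thesis unfolding holonomic_def by (rule finite_subset) simp
qed

lemma minimal_solution_singleton:
  "solution k a {s} \<Longrightarrow> minimal_solution k a {s}"
  by (auto simp: minimal_solution_def solution_def subset_singleton_iff)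

lemma not_holonomic_if_large_singletons:
  assumes "\<And>q. k \<le> q \<Longrightarrow> solution k a {q}"
  shows "\<not> holonomic k a"
proof
  assume "holonomic k a"
  moreover have "(\<lambda>q. {q}) ` {k..} \<subseteq> {S. minimal_solution k a S}"
    using assms by (auto intro: minimal_solution_singleton)
  ultimately have "finite ((\<lambda>q. {q}) ` {k..})"
    unfolding holonomic_def by (rule rev_finite_subset)
  then have "finite {k..}" by (rule finite_imageD) simp
  then show False by (simp add: infinite_Ici)
qed

theorem proposition3p6:
  fixes k :: nat and a :: "nat \<Rightarrow> int"
  assumes "k \<ge> 1"
  shows "(\<not> holonomic k a \<longleftrightarrow> (\<exists>s\<ge>k. solution k a {s})) \<and>
         (\<not> holonomic k a \<longrightarrow> (\<forall>q\<ge>k. solution k a {q}))"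
proof (cases "\<exists>s\<ge>k. solution k a {s}")
  case True
  then have "\<forall>q\<ge>k. solution k a {q}" by (auto simp: solution_singleton_iff)
  with True not_holonomic_if_large_singletons[of k a] show ?thesis by blast
next
  case False
  with holonomic_if_no_large_singleton[of k a] show ?thesis by blast
qed

end
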